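(* For any positive integer $n$, $$\sum_{\pi\in\mathcal D_{2n}} (-1)^{\ell_D(\pi)} t^{\mathrm{ddes}(\pi)}q^{\mathrm{dmaj}(\pi)}\prod_{i\in\mathrm{Neg}(\pi)}x_i = \prod_{i=1}^{n} (1-t^2q^{4i-2}) \sum_{\pi\in\mathcal D_{n}} t^{\mathrm{ddes}(\pi)}q^{2\,\mathrm{dmaj}(\pi)}\prod_{i\in\mathrm{Neg}(\pi)\setminus\{n\}}x_{2i-1}x_{2i}.$$
   Context: For $N\ge1$, $\mathcal B_N$ is the group of signed permutations: words $\pi=\pi_1\cdots\pi_N$ with $\pi_i\in\{\pm1,\dots,\pm N\}$ such that $|\pi_1|\cdots|\pi_N|$ is a permutation of $\{1,\dots,N\}$. $\mathrm{Neg}(\pi)=\{i:\pi_i<0\}$ (a set of positions), $\mathrm{neg}(\pi)=|\mathrm{Neg}(\pi)|$, and $\mathcal D_N=\{\pi\in\mathcal B_N:\mathrm{neg}(\pi)\text{ is even}\}$. Write $\bar i=-i$. Type $D$ length: $\ell_D(\pi)=\mathrm{inv}(\pi)-\sum_{i\in\mathrm{Neg}(\pi)}(\pi_i+1)$, where $\mathrm{inv}(\pi)=|\{(i,j):i<j,\ \pi_i>\pi_j\}|$ in the natural order of integers. For $\pi\in\mathcal B_N$: $\mathrm{Des}_F(\pi)=\{i\in\{1,\dots,N-1\}:\pi_i>\pi_{i+1}\}$ with respect to the linear order $\bar1<\bar2<\cdots<\bar N<1<2<\cdots<N$, $\mathrm{des}_F(\pi)=|\mathrm{Des}_F(\pi)|$,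 $\mathrm{maj}_F(\pi)=\sum_{i\in\mathrm{Des}_F(\pi)}i$, $\mathrm{fdes}(\pi)=2\,\mathrm{des}_F(\pi)+\delta(\pi_1<0)$ (where $\delta(\mathsf A)=1$ if $\mathsf A$ is true and $0$ otherwise), and $\mathrm{fmaj}(\pi)=2\,\mathrm{maj}_F(\pi)+\mathrm{neg}(\pi)$. For $\pi\in\mathcal D_N$: $\mathrm{ddes}(\pi)=\mathrm{fdes}(\pi_1\cdots\pi_{N-1}|\pi_N|)$ and $\mathrm{dmaj}(\pi)=\mathrm{fmaj}(\pi_1\cdots\pi_{N-1}|\pi_N|)$, computed in $\mathcal B_N$. $t,q,x_1,x_2,\dots$ are commuting indeterminates. *)

theory Defs
  imports Complex_Main "HOL-Combinatorics.Multiset_Permutations"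
begin

text \<open>A signed permutation is the word \<open>\<pi>\<^sub>1 \<dots> \<pi>\<^sub>N\<close>, as a list of integers. The entries, and all
  positions below, are counted from 1: \<open>ent w i\<close> is \<open>\<pi>\<^sub>i\<close>, for \<open>1 \<le> i \<le> length w\<close>.\<close>

definition ent :: "int list \<Rightarrow> nat \<Rightarrow> int" where
  "ent w i = w ! (i - 1)"

definition signed_perms :: "nat \<Rightarrow> int list set" where
  "signed_perms N = {w. map abs w \<in> permutations_of_set {1..int N}}"

definition Neg :: "int list \<Rightarrow> nat set" where
  "Neg w = {i \<in> {1..length w}. ent w i < 0}"

definition neg :: "int list \<Rightarrow> nat" where
  "neg w = card (Neg w)"

definition even_signed_perms :: "nat \<Rightarrow> int list set" where
  "even_signed_perms N = {w \<in> signed_perms N. even (neg w)}"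

definition invs :: "int list \<Rightarrow> nat" where
  "invs w = card {(i, j). 1 \<le> i \<and> i < j \<and> j \<le> length w \<and> ent w i > ent w j}"

definition length_D :: "int list \<Rightarrow> int" where
  "length_D w = int (invs w) - (\<Sum>i\<in>Neg w. ent w i + 1)"

text \<open>The length is never negative, so \<open>nat (length_D w)\<close> may be used as an exponent.\<close>

lemma length_D_nonneg: "length_D w \<ge> 0"
proof -
  have "(\<Sum>i\<in>Neg w. ent w i + 1) \<le> 0"
    by (rule sum_nonpos) (auto simp: Neg_def)
  then show ?thesis by (simp add: length_D_def)
qed

text \<open>The linear order \<open>-1 < -2 < \<dots> < -N < 1 < 2 < \<dots> < N\<close> (on nonzero integers).\<close>

definition less_F :: "int \<Rightarrow> int \<Rightarrow> bool" where
  "less_F a b \<longleftrightarrow> (a < 0 \<and> b > 0) \<or> (a < 0 \<and> b < 0 \<and> \<bar>a\<bar> < \<bar>b\<bar>) \<or> (a > 0 \<and> b > 0 \<and> a < b)"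

definition Des_F :: "int list \<Rightarrow> nat set" where
  "Des_F w = {i. 1 \<le> i \<and> i < length w \<and> less_F (ent w (i + 1)) (ent w i)}"

definition des_F :: "int list \<Rightarrow> nat" where
  "des_F w = card (Des_F w)"

definition maj_F :: "int list \<Rightarrow> nat" where
  "maj_F w = \<Sum>(Des_F w)"

definition fdes :: "int list \<Rightarrow> nat" where
  "fdes w = 2 * des_F w + (if ent w 1 < 0 then 1 else 0)"

definition fmaj :: "int list \<Rightarrow> nat" where
  "fmaj w = 2 * maj_F w + neg w"

definition abs_last :: "int list \<Rightarrow> int list" where
  "abs_last w = butlast w @ [\<bar>last w\<bar>]"

definition ddes :: "int list \<Rightarrow> nat" where
  "ddes w = fdes (abs_last w)"

definition dmaj :: "int list \<Rightarrow> nat" where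
  "dmaj w = fmaj (abs_last w)"

end

theory Submission
  imports Defs
begin

text \<open>Only the permutation \<open>\<bar>\<pi>\<bar>\<close> matters for the sign: \<open>(-1)\<^sup>\<ell>\<close> with \<open>\<ell> = \<ell>\<^sub>D(\<pi>)\<close> is the sign of \<open>\<bar>\<pi>\<bar>\<close>
  (\<open>even_length_D_iff\<close>).  The map \<^const>\<open>abs_last\<close> identifies \<open>\<D>\<^sub>N\<close> with the signed permutations whose last
  letter is positive, because the sign of the last letter is forced by parity
  (\<open>sum_even_signed_perms\<close>).  So both sides become sums over the signed permutations with a positive last
  letter, of a function of the descent set and of the set of negative positions, times the sign on the
  left-hand side.  The restriction can be hidden in the weight attached to the set of negative positions, and
  it remains to prove the identity \<open>signed_sum_fdes_fmaj\<close> for all signed permutations of length \<open>2n\<close>,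
  with an arbitrary such weight.

  Exchanging the absolute values \<open>2k - 1\<close> and \<open>2k\<close> in \<open>\<pi>\<close>, with the sign pattern kept, reverses the sign
  of \<open>\<bar>\<pi>\<bar>\<close>.  The two values are consecutive in the order \<open>-1 < -2 < \<dots> < 1 < 2 < \<dots>\<close> when they carry
  the same sign, and with different signs their comparison does not depend on the absolute values.
  So the exchange preserves the descent set unless the two letters have the same sign and stand
  next to each other.  Hence all words cancel (\<open>sum_unpaired_eq_0\<close>) except those in which, for every
  \<open>k\<close>, the letters of absolute value \<open>2k - 1\<close> and \<open>2k\<close> are adjacent and of the same sign; these pairs
  then have to fill the positions \<open>{1, 2}, {3, 4}, \<dots>\<close>.

  A surviving word is a signed permutation \<open>v\<close> of length \<open>n\<close> with each letter doubled, together with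
  the set \<open>E\<close> of the pairs that are written in decreasing order.  A descent of \<open>v\<close> at \<open>j\<close> becomes a
  descent at \<open>2j\<close>, and each \<open>j \<in> E\<close> gives one more inversion and a descent at \<open>2j - 1\<close>, which is the
  factor \<open>- t\<^sup>2 q\<^bsup>4j-2\<^esup>\<close>.  Summing over \<open>E\<close> gives the product.\<close>

section \<open>Signed permutations by positions\<close>

lemma signed_perms_iff:
  "w \<in> signed_perms N \<longleftrightarrow> length w = N \<and> abs ` set w = {1..int N}"
proof
  assume "w \<in> signed_perms N"
  then have s: "abs ` set w = {1..int N}" and d: "distinct (map abs w)"
    by (auto simp: signed_perms_def permutations_of_set_def)
  from distinct_card[OF d] s have "length w = N" by simp
  with s show "length w = N \<and> abs ` set w = {1..int N}" by simp
next
  assume a: "length w = N \<and> abs ` set w = {1..int N}"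
  then have "card (set (map abs w)) = length (map abs w)" by simp
  then have "distinct (map abs w)" by (rule card_distinct)
  with a show "w \<in> signed_perms N"
    by (auto simp: signed_perms_def permutations_of_set_def)
qed

lemma finite_signed_perms: "finite (signed_perms N)"
proof (rule finite_subset)
  show "signed_perms N \<subseteq> {w. set w \<subseteq> {- int N..int N} \<and> length w = N}"
    by (force simp: signed_perms_iff)
qed (simp add: finite_lists_length_eq)

lemma set_conv_ent: "set w = ent w ` {1..length w}"
proof -
  have "ent w ` {1..length w} = ent w ` Suc ` {..<length w}"
    by (simp only: image_Suc_lessThan)
  also have "\<dots> = (!) w ` {..<length w}"
    by (simp add: ent_def image_image)
  also have "\<dots> = set w"
    by (auto simp: set_conv_nth)
  finally show ?thesis ..
qed

lemma ent_map: "1 \<le> i \<Longrightarrow> i \<le> length w \<Longrightarrow> ent (map f w) i = f (ent w i)"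
  by (simp add: ent_def)

lemma ent_eqI:
  assumes "length v = length w" "\<And>i. 1 \<le> i \<Longrightarrow> i \<le> length w \<Longrightarrow> ent v i = ent w i"
  shows "v = w"
proof (rule nth_equalityI)
  fix m assume "m < length v"
  with assms(1) assms(2)[of "Suc m"] show "v ! m = w ! m" by (simp add: ent_def)
qed (fact assms(1))

lemma signed_perms_iff_ent:
  "w \<in> signed_perms N \<longleftrightarrow> length w = N \<and> (\<lambda>i. \<bar>ent w i\<bar>) ` {1..N} = {1..int N}"
  by (auto simp: signed_perms_iff set_conv_ent image_image)

lemma length_signed_perm: "w \<in> signed_perms N \<Longrightarrow> length w = N"
  by (simp add: signed_perms_iff)

lemma abs_ent_bounds:
  assumes "w \<in> signed_perms N" "1 \<le> i" "i \<le> N"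
  shows "1 \<le> \<bar>ent w i\<bar>" "\<bar>ent w i\<bar> \<le> int N"
proof -
  have "\<bar>ent w i\<bar> \<in> {1..int N}"
    using assms by (force simp: signed_perms_iff_ent)
  then show "1 \<le> \<bar>ent w i\<bar>" "\<bar>ent w i\<bar> \<le> int N" by auto
qed

lemma abs_ent_surj:
  assumes "w \<in> signed_perms N" "1 \<le> m" "m \<le> int N"
  obtains i where "1 \<le> i" "i \<le> N" "\<bar>ent w i\<bar> = m"
proof -
  have "m \<in> (\<lambda>i. \<bar>ent w i\<bar>) ` {1..N}"
    using assms by (simp add: signed_perms_iff_ent)
  then show ?thesis using that by auto
qed

lemma inj_on_abs_ent:
  assumes "w \<in> signed_perms N"
  shows "inj_on (\<lambda>i. \<bar>ent w i\<bar>) {1..N}"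
  using assms by (intro eq_card_imp_inj_on) (auto simp: signed_perms_iff_ent)

lemma abs_ent_inj:
  assumes "w \<in> signed_perms N" "\<bar>ent w i\<bar> = \<bar>ent w j\<bar>" "1 \<le> i" "i \<le> N" "1 \<le> j" "j \<le> N"
  shows "i = j"
  by (rule inj_onD[OF inj_on_abs_ent[OF assms(1)] assms(2)]) (use assms(3-) in auto)

section \<open>The parity of the length\<close>

lemma finite_position_pairs: "finite {(i, j). 1 \<le> i \<and> i < j \<and> j \<le> (N::nat) \<and> Q i j}"
  by (rule finite_subset[of _ "{1..N} \<times> {1..N}"]) auto

text \<open>In \<open>- (\<pi>\<^sub>i + 1) = \<bar>\<pi>\<^sub>i\<bar> - 1\<close> the right-hand side counts the entries of smaller absolute value.
  So \<open>\<ell>\<^sub>D\<close> is a sum over pairs of positions \<open>i < j\<close> of the indicator of \<open>\<pi>\<^sub>i > \<pi>\<^sub>j\<close> plus the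
  indicator that the entry with the larger absolute value is negative.  This contribution is 1 if
  \<open>\<bar>\<pi>\<^sub>i\<bar> > \<bar>\<pi>\<^sub>j\<bar>\<close>, and 0 or 2 otherwise.\<close>

lemma even_length_D_iff:
  assumes w: "w \<in> signed_perms N"
  shows "even (length_D w) \<longleftrightarrow> even (invs (map abs w))"
proof -
  \<comment> \<open>The inversions of \<open>w\<close> are \<open>L \<union> K\<close> and those of \<open>\<bar>w\<bar>\<close> are \<open>M \<union> K\<close>; the sum over the negative
    entries counts \<open>S\<close>, that is, \<open>L\<close> and \<open>M\<close> once each.  So \<open>L\<close> is counted twice in total.\<close>
  define below where "below i j \<longleftrightarrow> \<bar>ent w i\<bar> < \<bar>ent w j\<bar>" for i j
  define ng where "ng i \<longleftrightarrow> ent w i < 0" for i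
  define L where "L = {(i, j). 1 \<le> i \<and> i < j \<and> j \<le> N \<and> below i j \<and> ng j}"
  define M where "M = {(i, j). 1 \<le> i \<and> i < j \<and> j \<le> N \<and> below j i \<and> ng i}"
  define K where "K = {(i, j). 1 \<le> i \<and> i < j \<and> j \<le> N \<and> below j i \<and> \<not> ng i}"
  define S where "S = (SIGMA i:Neg w. {j \<in> {1..N}. below j i})"
  note len = length_signed_perm[OF w]
  have fin: "finite L" "finite M" "finite K"
    unfolding L_def M_def K_def by (rule finite_position_pairs)+
  have asym: "\<not> (below i j \<and> below j i)" for i j
    by (auto simp: below_def)
  have greater: "ent w i > ent w j \<longleftrightarrow> below i j \<and> ng j \<or> below j i \<and> \<not> ng i"
    if "1 \<le> i" "i < j" "j \<le> N" for i j
  proof -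
    have "\<bar>ent w i\<bar> \<noteq> \<bar>ent w j\<bar>"
      using abs_ent_inj[OF w, of i j] that by linarith
    then show ?thesis unfolding below_def ng_def by arith
  qed
  have "{(i, j). 1 \<le> i \<and> i < j \<and> j \<le> length w \<and> ent w i > ent w j} = L \<union> K"
    unfolding L_def K_def len using greater by blast
  moreover have "L \<inter> K = {}" using asym by (auto simp: L_def K_def)
  ultimately have 1: "invs w = card L + card K"
    unfolding invs_def using fin by (simp add: card_Un_disjoint)
  have "{(i, j). 1 \<le> i \<and> i < j \<and> j \<le> length (map abs w) \<and> ent (map abs w) i > ent (map abs w) j}
      = M \<union> K"
    by (auto simp: M_def K_def len ent_map below_def)
  moreover have "M \<inter> K = {}" by (auto simp: M_def K_def)
  ultimately have 2: "invs (map abs w) = card M + card K"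
    unfolding invs_def using fin by (simp add: card_Un_disjoint)
  have "S = prod.swap ` L \<union> M"
  proof (rule set_eqI)
    fix p :: "nat \<times> nat"
    obtain i j where p: "p = (i, j)" by (cases p)
    have "p \<in> S \<longleftrightarrow> 1 \<le> i \<and> i \<le> N \<and> ng i \<and> 1 \<le> j \<and> j \<le> N \<and> below j i"
      unfolding p S_def Neg_def len ng_def by auto
    moreover have "p \<in> prod.swap ` L \<longleftrightarrow> 1 \<le> j \<and> j < i \<and> i \<le> N \<and> below j i \<and> ng i"
      unfolding p L_def by (force simp: image_iff)
    moreover have "p \<in> M \<longleftrightarrow> 1 \<le> i \<and> i < j \<and> j \<le> N \<and> below j i \<and> ng i"
      unfolding p M_def by simp
    moreover have "\<not> below i i" using asym by blast
    ultimately show "p \<in> S \<longleftrightarrow> p \<in> prod.swap ` L \<union> M"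
      by (cases i j rule: linorder_cases) auto
  qed
  moreover have "prod.swap ` L \<inter> M = {}" by (auto simp: L_def M_def)
  ultimately have 3: "card S = card L + card M"
    using fin by (simp add: card_Un_disjoint card_image)
  have smaller: "int (card {j \<in> {1..N}. below j i}) = - (ent w i + 1)" if "i \<in> Neg w" for i
  proof -
    from that have i: "1 \<le> i" "i \<le> N" "ent w i < 0" by (auto simp: Neg_def len)
    have "(\<lambda>i. \<bar>ent w i\<bar>) ` {j \<in> {1..N}. below j i} = {1..<\<bar>ent w i\<bar>}" (is "?f ` ?J = _")
    proof (intro equalityI subsetI)
      fix m assume m: "m \<in> {1..<\<bar>ent w i\<bar>}"
      with abs_ent_bounds(2)[OF w i(1,2)] have "1 \<le> m" "m \<le> int N" by simp_all
      then obtain j where "1 \<le> j" "j \<le> N" "\<bar>ent w j\<bar> = m" by (rule abs_ent_surj[OF w])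
      with m show "m \<in> ?f ` ?J" by (intro image_eqI[of _ _ j]) (simp_all add: below_def)
    next
      fix m assume "m \<in> ?f ` ?J"
      then obtain j where "1 \<le> j" "j \<le> N" "below j i" "m = \<bar>ent w j\<bar>" by auto
      with abs_ent_bounds(1)[OF w, of j] show "m \<in> {1..<\<bar>ent w i\<bar>}" by (simp add: below_def)
    qed
    moreover have "inj_on ?f ?J" using inj_on_abs_ent[OF w] by (rule inj_on_subset) auto
    ultimately have "card ?J = card {1..<\<bar>ent w i\<bar>}" by (metis card_image)
    then show ?thesis using i by simp
  qed
  have "int (card S) = (\<Sum>i\<in>Neg w. - (ent w i + 1))"
    unfolding S_def using smaller by (subst card_SigmaI) (auto simp: Neg_def)
  then have "length_D w = int (invs w) + int (card S)"
    by (simp only: length_D_def sum_negf diff_conv_add_uminus)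
  then have "length_D w = int (invs (map abs w)) + 2 * int (card L)"
    using 1 2 3 by simp
  then show ?thesis by simp
qed

text \<open>Two consecutive values compare alike with every other value, so only the pair of the two
  positions \<open>a\<close> and \<open>b\<close> themselves enters or leaves the set of inversions.\<close>

lemma even_invs_swap_consecutive_values:
  fixes p :: "int list"
  assumes ab: "1 \<le> a" "a < b" "b \<le> length p"
    and vals: "{ent p a, ent p b} = {m, m + 1}"
    and rest: "\<And>i. 1 \<le> i \<Longrightarrow> i \<le> length p \<Longrightarrow> i \<noteq> a \<Longrightarrow> i \<noteq> b \<Longrightarrow> ent p i \<noteq> m \<and> ent p i \<noteq> m + 1"
    and p': "length p' = length p" "ent p' a = ent p b" "ent p' b = ent p a"
      "\<And>i. 1 \<le> i \<Longrightarrow> i \<le> length p \<Longrightarrow> i \<noteq> a \<Longrightarrow> i \<noteq> b \<Longrightarrow> ent p' i = ent p i"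
  shows "even (invs p') \<longleftrightarrow> odd (invs p)"
proof -
  let ?I = "\<lambda>u. {(i, j). 1 \<le> i \<and> i < j \<and> j \<le> length p \<and> ent u i > ent u j}"
  have fin: "finite (?I u)" for u by (rule finite_position_pairs)
  have vals': "ent p a = m \<and> ent p b = m + 1 \<or> ent p a = m + 1 \<and> ent p b = m"
    using vals by (auto simp: doubleton_eq_iff)
  have same: "ent p' i > ent p' j \<longleftrightarrow> ent p i > ent p j"
    if ij: "1 \<le> i" "i < j" "j \<le> length p" "(i, j) \<noteq> (a, b)" for i j
  proof -
    consider "i = a" "j \<noteq> b" | "i = b" | "i \<noteq> a" "i \<noteq> b" "j = a" | "i \<noteq> a" "j = b"
      | "i \<noteq> a" "i \<noteq> b" "j \<noteq> a" "j \<noteq> b" using ij by blast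
    then show ?thesis
      using vals' rest[of i] rest[of j] p'(2-3) p'(4)[of i] p'(4)[of j] ij ab
      by cases auto
  qed
  have eq: "?I p' - {(a, b)} = ?I p - {(a, b)}"
    using same by auto
  have flip: "(a, b) \<in> ?I p' \<longleftrightarrow> (a, b) \<notin> ?I p"
    using vals' p' ab by auto
  have split: "card (?I u) = card (?I u - {(a, b)}) + (if (a, b) \<in> ?I u then 1 else 0)" for u
    using card.remove[OF fin, of "(a, b)" u] by (cases "(a, b) \<in> ?I u") simp_all
  have "invs p' = card (?I p - {(a, b)}) + (if (a, b) \<in> ?I p' then 1 else 0)"
    unfolding invs_def p'(1) using split[of p'] unfolding eq .
  moreover have "invs p = card (?I p - {(a, b)}) + (if (a, b) \<in> ?I p then 1 else 0)"
    unfolding invs_def using split[of p] .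
  ultimately show ?thesis using flip by auto
qed


section \<open>Pairs of values\<close>

definition half :: "int \<Rightarrow> int" where
  "half a = sgn a * ((\<bar>a\<bar> + 1) div 2)"

text \<open>The other value with the same \<open>half\<close>; so \<open>1, 2\<close> are mates, and \<open>-1, -2\<close>, and \<open>3, 4\<close>, and
  so on.\<close>

definition mate :: "int \<Rightarrow> int" where
  "mate a = (if odd a then a + sgn a else a - sgn a)"

definition swap_pair :: "int \<Rightarrow> int \<Rightarrow> int" where
  "swap_pair k a = (if \<bar>half a\<bar> = k then mate a else a)"

lemma abs_half: "\<bar>half a\<bar> = (\<bar>a\<bar> + 1) div 2"
  by (auto simp: half_def abs_mult sgn_if)

lemma half_pos_iff: "half a > 0 \<longleftrightarrow> a > 0"
  by (auto simp: half_def sgn_if zero_less_mult_iff)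

lemma half_neg_iff: "half a < 0 \<longleftrightarrow> a < 0"
proof -
  have "(1 - a) div 2 > 0" if "a < 0" using that by linarith
  then show ?thesis by (auto simp: half_def sgn_if)
qed

lemma half_eq_iff: "half a = half b \<longleftrightarrow> sgn a = sgn b \<and> (\<bar>a\<bar> + 1) div 2 = (\<bar>b\<bar> + 1) div 2"
proof
  assume h: "half a = half b"
  have "sgn a = sgn b"
  proof -
    have "a > 0 \<longleftrightarrow> b > 0" "a < 0 \<longleftrightarrow> b < 0"
      using half_pos_iff half_neg_iff h by metis+
    then show ?thesis unfolding sgn_if by (smt (verit))
  qed
  moreover have "(\<bar>a\<bar> + 1) div 2 = (\<bar>b\<bar> + 1) div 2"
    using h unfolding abs_half[symmetric] by (rule arg_cong)
  ultimately show "sgn a = sgn b \<and> (\<bar>a\<bar> + 1) div 2 = (\<bar>b\<bar> + 1) div 2" ..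
qed (simp add: half_def)

lemma sgn_mate: "sgn (mate a) = sgn a"
proof -
  have "a \<ge> 2 \<or> a = 0 \<or> a \<le> -2" if "even a" using that by presburger
  then show ?thesis by (auto simp: mate_def sgn_if)
qed

lemma mate_mate: "mate (mate a) = a"
  unfolding mate_def[of "mate a"] sgn_mate by (auto simp: mate_def sgn_if)

lemma abs_mate: "\<bar>mate a\<bar> = mate \<bar>a\<bar>"
proof -
  have "a \<ge> 2 \<or> a = 0 \<or> a \<le> -2" if "even a" using that by presburger
  then show ?thesis by (auto simp: mate_def sgn_if)
qed

lemma half_mate: "half (mate a) = half a"
proof -
  have "(mate \<bar>a\<bar> + 1) div 2 = (\<bar>a\<bar> + 1) div 2"
    by (auto simp: mate_def sgn_if elim!: evenE oddE)
  then show ?thesis by (simp add: half_def sgn_mate abs_mate)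
qed

lemma half_div_eq_cases:
  fixes a b :: int
  assumes "(a + 1) div 2 = (b + 1) div 2" "a > 0" "b > 0"
  shows "b = a \<or> b = mate a"
proof -
  have "b = a \<or> (if odd a then b = a + 1 else b = a - 1)"
    using assms(1) by presburger
  then show ?thesis using assms(2) by (auto simp: mate_def sgn_if split: if_splits)
qed

lemma abs_half_eq_cases:
  assumes "\<bar>half a\<bar> = \<bar>half b\<bar>" "a \<noteq> 0" "b \<noteq> 0"
  shows "\<bar>b\<bar> = \<bar>a\<bar> \<or> \<bar>b\<bar> = \<bar>mate a\<bar>"
  unfolding abs_mate using assms by (intro half_div_eq_cases) (auto simp: abs_half)

lemma half_eq_cases:
  assumes "half a = half b" "a \<noteq> 0" "b \<noteq> 0"
  shows "b = a \<or> b = mate a"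
proof -
  have "\<bar>b\<bar> = \<bar>a\<bar> \<or> \<bar>b\<bar> = \<bar>mate a\<bar>" using assms by (intro abs_half_eq_cases) simp_all
  moreover have "sgn a = sgn b" using assms(1) by (simp add: half_eq_iff)
  ultimately show ?thesis by (metis mult_sgn_abs sgn_mate)
qed

lemma less_F_iff_abs:
  "less_F a b \<longleftrightarrow> a < 0 \<and> b > 0 \<or> (a < 0 \<and> b < 0 \<or> a > 0 \<and> b > 0) \<and> \<bar>a\<bar> < \<bar>b\<bar>"
  by (auto simp: less_F_def)

text \<open>Mates are neighbours in the order \<open>-1 < -2 < \<dots> < 1 < 2 < \<dots>\<close>, so every comparison other than
  the one between mates can be read off from the halves.\<close>

lemma less_F_half:
  assumes "half a \<noteq> half b"
  shows "less_F (half a) (half b) \<longleftrightarrow> less_F a b"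
proof -
  have "\<bar>half a\<bar> < \<bar>half b\<bar> \<longleftrightarrow> \<bar>a\<bar> < \<bar>b\<bar>" if "sgn a = sgn b"
  proof -
    have "(\<bar>a\<bar> + 1) div 2 \<noteq> (\<bar>b\<bar> + 1) div 2"
      using assms that by (simp add: half_eq_iff)
    then show ?thesis unfolding abs_half by linarith
  qed
  then have "a < 0 \<and> b < 0 \<or> a > 0 \<and> b > 0 \<Longrightarrow> \<bar>half a\<bar> < \<bar>half b\<bar> \<longleftrightarrow> \<bar>a\<bar> < \<bar>b\<bar>"
    by (auto simp: sgn_if)
  then show ?thesis
    unfolding less_F_iff_abs half_pos_iff half_neg_iff by blast
qed

lemma half_double: "half (2 * a) = a"
  by (auto simp: half_def sgn_if abs_mult)

text \<open>The two values with half \<open>a\<close> are \<open>2 * a\<close> and \<open>2 * a - sgn a\<close>; the second one has the smaller absolute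
  value, and precedes the first in \<^const>\<open>less_F\<close> for both signs of \<open>a\<close>.\<close>

lemma half_double_minus: "a \<noteq> 0 \<Longrightarrow> half (2 * a - sgn a) = a"
  by (auto simp: half_def sgn_if)

lemma less_F_mate_double: "a \<noteq> 0 \<Longrightarrow> less_F (2 * a - sgn a) (2 * a)"
  by (auto simp: less_F_def sgn_if)

lemma less_F_asym: "less_F a b \<Longrightarrow> \<not> less_F b a"
  by (auto simp: less_F_def)

lemma mate_double: "mate (2 * a) = 2 * a - sgn a"
  by (auto simp: mate_def sgn_if)

lemma swap_pair_swap_pair: "swap_pair k (swap_pair k a) = a"
  by (simp add: swap_pair_def half_mate mate_mate)

lemma half_swap_pair: "half (swap_pair k a) = half a"
  by (simp add: swap_pair_def half_mate)

lemma swap_pair_neg_iff: "swap_pair k a < 0 \<longleftrightarrow> a < 0"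
  using half_neg_iff[of "swap_pair k a"] half_neg_iff[of a] by (simp add: half_swap_pair)

lemma abs_swap_pair: "\<bar>swap_pair k a\<bar> = swap_pair k \<bar>a\<bar>"
  by (simp add: swap_pair_def abs_half abs_mate)

lemma less_F_swap_pair:
  assumes "\<not> (half a = half b \<and> \<bar>half a\<bar> = k)"
  shows "less_F (swap_pair k a) (swap_pair k b) \<longleftrightarrow> less_F a b"
proof (cases "half a = half b")
  case True
  with assms show ?thesis by (simp add: swap_pair_def)
next
  case False
  then show ?thesis
    using less_F_half[of a b] less_F_half[of "swap_pair k a" "swap_pair k b"]
    by (simp add: half_swap_pair)
qed


section \<open>The sign-reversing involution\<close>

lemma ent_nonzero: "w \<in> signed_perms N \<Longrightarrow> 1 \<le> i \<Longrightarrow> i \<le> N \<Longrightarrow> ent w i \<noteq> 0"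
  using abs_ent_bounds(1)[of w N i] by linarith

lemma swap_pair_image:
  assumes "1 \<le> k" "k \<le> int n"
  shows "swap_pair k ` {1..int (2 * n)} = {1..int (2 * n)}"
proof -
  have sub: "swap_pair k m \<in> {1..int (2 * n)}" if m: "m \<in> {1..int (2 * n)}" for m
  proof (cases "\<bar>half m\<bar> = k")
    case True
    with m assms have "(m + 1) div 2 \<le> int n" by (simp add: abs_half)
    moreover have "m > 0" using m by simp
    ultimately have "1 \<le> mate m \<and> mate m \<le> 2 * int n"
      unfolding mate_def by (simp add: sgn_if) presburger
    with True show ?thesis by (simp add: swap_pair_def)
  qed (use m in \<open>simp add: swap_pair_def\<close>)
  show ?thesis
  proof (intro equalityI subsetI)
    fix m assume "m \<in> {1..int (2 * n)}"
    then show "m \<in> swap_pair k ` {1..int (2 * n)}"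
      by (intro image_eqI[of _ _ "swap_pair k m"] sub) (simp add: swap_pair_swap_pair)
  qed (use sub in blast)
qed

lemma map_swap_pair_signed_perms:
  assumes w: "w \<in> signed_perms (2 * n)" and k: "1 \<le> k" "k \<le> int n"
  shows "map (swap_pair k) w \<in> signed_perms (2 * n)"
proof -
  have "abs ` set (map (swap_pair k) w) = swap_pair k ` (abs ` set w)"
    by (simp add: image_image abs_swap_pair)
  with w swap_pair_image[OF k] show ?thesis by (simp add: signed_perms_iff)
qed

lemma Neg_map_swap_pair: "Neg (map (swap_pair k) w) = Neg w"
  by (auto simp: Neg_def ent_map swap_pair_neg_iff)

lemma Des_F_map_swap_pair:
  assumes "\<And>i. 1 \<le> i \<Longrightarrow> i < length w \<Longrightarrow>
    \<not> (half (ent w i) = half (ent w (i + 1)) \<and> \<bar>half (ent w i)\<bar> = k)"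
  shows "Des_F (map (swap_pair k) w) = Des_F w"
proof -
  have "less_F (ent (map (swap_pair k) w) (i + 1)) (ent (map (swap_pair k) w) i)
      \<longleftrightarrow> less_F (ent w (i + 1)) (ent w i)" if "1 \<le> i" "i < length w" for i
  proof -
    have "\<not> (half (ent w (i + 1)) = half (ent w i) \<and> \<bar>half (ent w (i + 1))\<bar> = k)"
      using assms[OF that] by metis
    from less_F_swap_pair[OF this] that show ?thesis by (simp add: ent_map)
  qed
  then show ?thesis unfolding Des_F_def by auto
qed

lemma even_invs_map_swap_pair:
  assumes w: "w \<in> signed_perms (2 * n)" and k: "1 \<le> k" "k \<le> int n"
  shows "even (invs (map abs (map (swap_pair k) w))) \<longleftrightarrow> odd (invs (map abs w))"
proof -
  note len = length_signed_perm[OF w]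
  have bounds: "1 \<le> 2 * k - 1" "2 * k - 1 \<le> int (2 * n)" "1 \<le> 2 * k" "2 * k \<le> int (2 * n)"
    using k by auto
  obtain a where a: "1 \<le> a" "a \<le> 2 * n" "\<bar>ent w a\<bar> = 2 * k - 1"
    by (rule abs_ent_surj[OF w bounds(1,2)])
  obtain b where b: "1 \<le> b" "b \<le> 2 * n" "\<bar>ent w b\<bar> = 2 * k"
    by (rule abs_ent_surj[OF w bounds(3,4)])
  have neq: "a \<noteq> b" using a b by auto
  have other: "\<bar>ent w i\<bar> \<noteq> 2 * k - 1 \<and> \<bar>ent w i\<bar> \<noteq> 2 * k"
    if "1 \<le> i" "i \<le> 2 * n" "i \<noteq> a" "i \<noteq> b" for i
    using abs_ent_inj[OF w, of i a] abs_ent_inj[OF w, of i b] that a b by auto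
  have fix': "swap_pair k \<bar>ent w i\<bar> = \<bar>ent w i\<bar>"
    if "1 \<le> i" "i \<le> 2 * n" "i \<noteq> a" "i \<noteq> b" for i
  proof -
    have "(\<bar>ent w i\<bar> + 1) div 2 \<noteq> k" using other[OF that] by presburger
    then show ?thesis by (simp add: swap_pair_def abs_half)
  qed
  have half_k: "\<bar>half (2 * k - 1)\<bar> = k" "\<bar>half (2 * k)\<bar> = k" using k by (auto simp: abs_half)
  have sw: "swap_pair k (2 * k - 1) = 2 * k" "swap_pair k (2 * k) = 2 * k - 1"
    unfolding swap_pair_def half_k using k by (auto simp: mate_def)
  define p where "p = map abs w"
  define p' where "p' = map abs (map (swap_pair k) w)"
  have lenp: "length p = 2 * n" "length p' = length p" by (simp_all add: p_def p'_def len)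
  have p: "ent p i = \<bar>ent w i\<bar>" "ent p' i = swap_pair k \<bar>ent w i\<bar>" if "1 \<le> i" "i \<le> 2 * n" for i
    using that by (simp_all add: p_def p'_def len ent_map abs_swap_pair)
  have at_a: "ent p a = 2 * k - 1" "ent p' a = 2 * k" and at_b: "ent p b = 2 * k" "ent p' b = 2 * k - 1"
    using p[OF a(1,2)] p[OF b(1,2)] a b sw by simp_all
  have at_other: "ent p i \<noteq> 2 * k - 1 \<and> ent p i \<noteq> 2 * k - 1 + 1" "ent p' i = ent p i"
    if "1 \<le> i" "i \<le> 2 * n" "i \<noteq> a" "i \<noteq> b" for i
    using p[OF that(1,2)] other[OF that] fix'[OF that] by simp_all
  consider "a < b" | "b < a" using neq by linarith
  then have "even (invs p') \<longleftrightarrow> odd (invs p)"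
  proof cases
    case 1
    show ?thesis
      by (rule even_invs_swap_consecutive_values[of a b p "2 * k - 1"])
         (use 1 a b lenp at_a at_b at_other in simp_all)
  next
    case 2
    show ?thesis
      by (rule even_invs_swap_consecutive_values[of b a p "2 * k - 1"])
         (use 2 a b lenp at_a at_b at_other in \<open>simp_all add: insert_commute\<close>)
  qed
  then show ?thesis by (simp only: p_def p'_def)
qed

definition unpaired_at :: "nat \<Rightarrow> int list \<Rightarrow> nat \<Rightarrow> bool" where
  "unpaired_at n w j \<longleftrightarrow> 1 \<le> j \<and> j \<le> n \<and> half (ent w (2 * j - 1)) \<noteq> half (ent w (2 * j))"

definition paired :: "nat \<Rightarrow> int list \<Rightarrow> bool" where
  "paired n w \<longleftrightarrow> (\<forall>j. \<not> unpaired_at n w j)"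

text \<open>The pair of values to be swapped is determined by the halves of the entries alone.  The swap
  leaves these fixed, so a second application chooses the same pair, and the map is an involution.\<close>

definition swap_first_unpaired :: "nat \<Rightarrow> int list \<Rightarrow> int list" where
  "swap_first_unpaired n w =
     map (swap_pair \<bar>half (ent w (2 * (LEAST j. unpaired_at n w j) - 1))\<bar>) w"

lemma unpaired_at_map_swap_pair:
  assumes "length w = 2 * n"
  shows "unpaired_at n (map (swap_pair k) w) j \<longleftrightarrow> unpaired_at n w j"
proof -
  have "half (ent (map (swap_pair k) w) i) = half (ent w i)" if "1 \<le> i" "i \<le> 2 * n" for i
    using that assms by (simp add: ent_map half_swap_pair)
  then show ?thesis unfolding unpaired_at_def by (cases "1 \<le> j \<and> j \<le> n") auto
qed

lemma abs_half_ent_bounds: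
  assumes "w \<in> signed_perms (2 * n)" "1 \<le> i" "i \<le> 2 * n"
  shows "1 \<le> \<bar>half (ent w i)\<bar>" "\<bar>half (ent w i)\<bar> \<le> int n"
  using abs_ent_bounds[OF assms] unfolding abs_half by auto

lemma no_three_equal_abs_halves:
  assumes w: "w \<in> signed_perms (2 * n)" and "{i, j, l} \<subseteq> {1..2 * n}"
    and "\<bar>half (ent w i)\<bar> = \<bar>half (ent w j)\<bar>" "\<bar>half (ent w i)\<bar> = \<bar>half (ent w l)\<bar>"
  shows "i = j \<or> i = l \<or> j = l"
proof -
  have nz: "ent w i \<noteq> 0" "ent w j \<noteq> 0" "ent w l \<noteq> 0"
    using assms ent_nonzero[OF w] by simp_all
  have "\<bar>ent w j\<bar> = \<bar>ent w i\<bar> \<or> \<bar>ent w j\<bar> = \<bar>mate (ent w i)\<bar>"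
    "\<bar>ent w l\<bar> = \<bar>ent w i\<bar> \<or> \<bar>ent w l\<bar> = \<bar>mate (ent w i)\<bar>"
    using abs_half_eq_cases[OF assms(3) nz(1,2)] abs_half_eq_cases[OF assms(4) nz(1,3)] .
  moreover have "x = y" if "\<bar>ent w x\<bar> = \<bar>ent w y\<bar>" "x \<in> {i, j, l}" "y \<in> {i, j, l}" for x y
    using abs_ent_inj[OF w that(1)] assms(2) that(2,3) by auto
  ultimately show ?thesis by (metis insert_iff)
qed

text \<open>This is what makes the swap preserve descents.  The pairs of positions before the first unpaired
  one are each filled by two values with equal halves, so a third value with that absolute half
  cannot follow; and the position after \<open>2 * j - 1\<close> is excluded by the choice of \<open>j\<close>.\<close>

lemma first_unpaired_not_adjacent:
  assumes w: "w \<in> signed_perms (2 * n)" and j: "unpaired_at n w j"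
    and least: "\<And>j'. unpaired_at n w j' \<Longrightarrow> j \<le> j'"
    and i: "1 \<le> i" "i < 2 * n"
  shows "\<not> (half (ent w i) = half (ent w (i + 1)) \<and> \<bar>half (ent w i)\<bar> = \<bar>half (ent w (2 * j - 1))\<bar>)"
proof
  assume h: "half (ent w i) = half (ent w (i + 1)) \<and> \<bar>half (ent w i)\<bar> = \<bar>half (ent w (2 * j - 1))\<bar>"
  have jn: "1 \<le> j" "j \<le> n" and ne: "half (ent w (2 * j - 1)) \<noteq> half (ent w (2 * j))"
    using j by (auto simp: unpaired_at_def)
  have "i = i + 1 \<or> i = 2 * j - 1 \<or> i + 1 = 2 * j - 1"
    using h i jn by (intro no_three_equal_abs_halves[OF w]) auto
  moreover have "i \<noteq> 2 * j - 1" using h ne jn by auto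
  ultimately have i': "i + 1 = 2 * j - 1" by simp
  then have j2: "j \<ge> 2" "i = 2 * (j - 1)" using i by auto
  have "\<not> unpaired_at n w (j - 1)" using least[of "j - 1"] j2 by auto
  moreover have "1 \<le> j - 1" "j - 1 \<le> n" using j2 jn by auto
  ultimately have "half (ent w (i - 1)) = half (ent w i)"
    unfolding unpaired_at_def j2(2) by blast
  moreover have "2 \<le> i" using j2 by simp
  ultimately have "i - 1 = i \<or> i - 1 = i + 1 \<or> i = i + 1"
    using h i by (intro no_three_equal_abs_halves[OF w]) auto
  with i show False by arith
qed

text \<open>The predicate \<open>P\<close> cuts \<open>A\<close> into two halves that \<open>\<phi>\<close> exchanges.  It is needed because
  \<open>sum f A = - sum f A\<close> does not give \<open>sum f A = 0\<close> in a ring of characteristic 2.\<close>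

lemma sum_eq_0_sign_reversing_involution:
  fixes f :: "'b \<Rightarrow> 'a :: comm_ring_1"
  assumes "finite A" "\<And>a. a \<in> A \<Longrightarrow> \<phi> a \<in> A" "\<And>a. a \<in> A \<Longrightarrow> \<phi> (\<phi> a) = a"
    and "\<And>a. a \<in> A \<Longrightarrow> f (\<phi> a) = - f a"
    and P: "\<And>a. a \<in> A \<Longrightarrow> P (\<phi> a) \<longleftrightarrow> \<not> P a"
  shows "sum f A = 0"
proof -
  have "sum f {a \<in> A. \<not> P a} = (\<Sum>a\<in>{a \<in> A. P a}. - f a)"
    by (rule sum.reindex_bij_witness[of _ \<phi> \<phi>]) (use assms in auto)
  moreover have "sum f A = sum f {a \<in> A. P a} + sum f {a \<in> A. \<not> P a}"
    using assms(1) by (subst sum.union_disjoint[symmetric]) (auto intro!: sum.cong)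
  ultimately show ?thesis by (simp add: sum_negf)
qed

text \<open>Flag descents and flag major index depend on \<open>w\<close> through its descent set and its negative
  positions only, and the swap preserves both of these sets.\<close>

lemma sum_unpaired_eq_0:
  fixes g :: "nat set \<Rightarrow> nat set \<Rightarrow> 'a :: comm_ring_1"
  shows "(\<Sum>w\<in>{w \<in> signed_perms (2 * n). \<not> paired n w}.
           (- 1) ^ invs (map abs w) * g (Des_F w) (Neg w)) = 0"
proof (rule sum_eq_0_sign_reversing_involution[where \<phi> = "swap_first_unpaired n"
      and P = "\<lambda>w. even (invs (map abs w))"])
  fix w assume "w \<in> {w \<in> signed_perms (2 * n). \<not> paired n w}"
  then have w: "w \<in> signed_perms (2 * n)" and "\<exists>j. unpaired_at n w j" by (auto simp: paired_def)
  define j where "j = (LEAST j. unpaired_at n w j)"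
  define k where "k = \<bar>half (ent w (2 * j - 1))\<bar>"
  have j: "unpaired_at n w j" unfolding j_def by (rule LeastI_ex) fact
  have least: "j \<le> j'" if "unpaired_at n w j'" for j' unfolding j_def using that by (rule Least_le)
  note len = length_signed_perm[OF w]
  have k: "1 \<le> k" "k \<le> int n"
    using abs_half_ent_bounds[OF w, of "2 * j - 1"] j by (auto simp: k_def unpaired_at_def)
  have sw: "swap_first_unpaired n w = map (swap_pair k) w"
    by (simp add: swap_first_unpaired_def k_def j_def)
  have unp: "unpaired_at n (map (swap_pair k) w) = unpaired_at n w"
    using unpaired_at_map_swap_pair[OF len] by blast
  show "swap_first_unpaired n w \<in> {w \<in> signed_perms (2 * n). \<not> paired n w}"
    using map_swap_pair_signed_perms[OF w k] j by (auto simp: sw unp paired_def)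
  have "half (ent (map (swap_pair k) w) (2 * j - 1)) = half (ent w (2 * j - 1))"
  proof -
    have "1 \<le> 2 * j - 1" "2 * j - 1 \<le> length w" using j by (auto simp: unpaired_at_def len)
    then show ?thesis by (simp only: ent_map half_swap_pair)
  qed
  then have "swap_first_unpaired n (map (swap_pair k) w) = map (swap_pair k) (map (swap_pair k) w)"
    unfolding swap_first_unpaired_def unp j_def[symmetric] by (simp add: k_def)
  then show "swap_first_unpaired n (swap_first_unpaired n w) = w"
    by (simp add: sw comp_def swap_pair_swap_pair)
  have inv: "even (invs (map abs (swap_first_unpaired n w))) \<longleftrightarrow> odd (invs (map abs w))"
    unfolding sw by (rule even_invs_map_swap_pair[OF w k])
  then show "even (invs (map abs (swap_first_unpaired n w))) \<longleftrightarrow> \<not> even (invs (map abs w))" .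
  have "Des_F (swap_first_unpaired n w) = Des_F w"
    unfolding sw k_def
    by (rule Des_F_map_swap_pair, rule first_unpaired_not_adjacent[OF w j least]) (simp_all add: len)
  then show "(- 1) ^ invs (map abs (swap_first_unpaired n w)) *
        g (Des_F (swap_first_unpaired n w)) (Neg (swap_first_unpaired n w))
      = - ((- 1) ^ invs (map abs w) * g (Des_F w) (Neg w))"
    using inv by (simp add: minus_one_power_iff sw Neg_map_swap_pair)
qed (simp add: finite_signed_perms)


section \<open>Doubled words\<close>

text \<open>Each letter \<open>a\<close> of \<open>v\<close> becomes the pair of letters with half \<open>a\<close>, in decreasing order at the
  places in \<open>E\<close> and in increasing order at the others, with respect to \<^const>\<open>less_F\<close>.  An even index
  \<open>m\<close>, counted from 0, is the first place of its pair.\<close>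

definition double_word :: "int list \<Rightarrow> nat set \<Rightarrow> int list" where
  "double_word v E = map (\<lambda>m. let j = Suc (m div 2); a = ent v j
     in if even m \<longleftrightarrow> j \<in> E then 2 * a else 2 * a - sgn a) [0..<2 * length v]"

definition halve_word :: "int list \<Rightarrow> int list" where
  "halve_word w = map (\<lambda>m. half (ent w (2 * Suc m))) [0..<length w div 2]"

definition reversed_pairs :: "nat \<Rightarrow> int list \<Rightarrow> nat set" where
  "reversed_pairs n w = {j \<in> {1..n}. less_F (ent w (2 * j)) (ent w (2 * j - 1))}"

lemma length_double_word [simp]: "length (double_word v E) = 2 * length v"
  by (simp add: double_word_def)

lemma ent_double_word:
  assumes "1 \<le> j" "j \<le> length v"
  shows "ent (double_word v E) (2 * j - 1) = (if j \<in> E then 2 * ent v j else 2 * ent v j - sgn (ent v j))"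
    and "ent (double_word v E) (2 * j) = (if j \<in> E then 2 * ent v j - sgn (ent v j) else 2 * ent v j)"
proof -
  obtain m where j: "j = Suc m" using assms by (cases j) auto
  have "2 * j - 1 - 1 = 2 * m" "2 * j - 1 = Suc (2 * m)" "Suc (2 * m) < 2 * length v"
    using assms j by auto
  then show
    "ent (double_word v E) (2 * j - 1) = (if j \<in> E then 2 * ent v j else 2 * ent v j - sgn (ent v j))"
    "ent (double_word v E) (2 * j) = (if j \<in> E then 2 * ent v j - sgn (ent v j) else 2 * ent v j)"
    unfolding ent_def[of "double_word v E"] by (simp_all add: double_word_def j Let_def)
qed

lemma ent_halve_word:
  assumes "length w = 2 * n" "1 \<le> j" "j \<le> n"
  shows "ent (halve_word w) j = half (ent w (2 * j))"
proof -
  obtain m where "j = Suc m" using assms by (cases j) auto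
  with assms show ?thesis by (simp add: halve_word_def ent_def)
qed

lemma position_in_pair:
  fixes i :: nat
  assumes "1 \<le> i" "i \<le> 2 * n"
  obtains j where "1 \<le> j" "j \<le> n" "i = 2 * j - 1 \<or> i = 2 * j"
proof
  show "1 \<le> (i + 1) div 2" "(i + 1) div 2 \<le> n" using assms by auto
  show "i = 2 * ((i + 1) div 2) - 1 \<or> i = 2 * ((i + 1) div 2)" using assms by presburger
qed

lemma pair_position_inj:
  fixes i j c d :: nat
  assumes "1 \<le> i" "1 \<le> j" "c \<in> {0, 1}" "d \<in> {0, 1}" "2 * i - c = 2 * j - d"
  shows "i = j \<and> c = d"
proof -
  have "2 * i \<noteq> 2 * j - 1" using assms(2) by presburger
  moreover have "2 * i - 1 \<noteq> 2 * j" using assms(1) by presburger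
  ultimately show ?thesis using assms by auto
qed

lemma half_ent_double_word:
  assumes "v \<in> signed_perms n" "1 \<le> j" "j \<le> n"
  shows "half (ent (double_word v E) (2 * j - 1)) = ent v j"
    and "half (ent (double_word v E) (2 * j)) = ent v j"
  using ent_double_word[of j v E] length_signed_perm[OF assms(1)] ent_nonzero[OF assms] assms(2,3)
  by (simp_all add: half_double half_double_minus)

lemma double_word_signed_perms:
  assumes v: "v \<in> signed_perms n"
  shows "double_word v E \<in> signed_perms (2 * n)"
proof -
  note len = length_signed_perm[OF v]
  let ?w = "double_word v E"
  have bounds: "1 \<le> \<bar>a\<bar> \<and> \<bar>a\<bar> \<le> int (2 * n)" if "1 \<le> \<bar>half a\<bar>" "\<bar>half a\<bar> \<le> int n" for a
    using that unfolding abs_half by auto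
  have "(\<lambda>i. \<bar>ent ?w i\<bar>) ` {1..2 * n} = {1..int (2 * n)}"
  proof (intro equalityI subsetI)
    fix m assume "m \<in> (\<lambda>i. \<bar>ent ?w i\<bar>) ` {1..2 * n}"
    then obtain i where i: "1 \<le> i" "i \<le> 2 * n" and m: "m = \<bar>ent ?w i\<bar>" by auto
    from i obtain j where j: "1 \<le> j" "j \<le> n" "i = 2 * j - 1 \<or> i = 2 * j" by (rule position_in_pair)
    have "half (ent ?w i) = ent v j" using half_ent_double_word[OF v j(1,2)] j(3) by auto
    then show "m \<in> {1..int (2 * n)}"
      using bounds[of "ent ?w i"] abs_ent_bounds[OF v j(1,2)] by (simp add: m)
  next
    fix m assume m: "m \<in> {1..int (2 * n)}"
    then have "1 \<le> (m + 1) div 2" "(m + 1) div 2 \<le> int n" by auto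
    then obtain j where j: "1 \<le> j" "j \<le> n" "\<bar>ent v j\<bar> = (m + 1) div 2" by (rule abs_ent_surj[OF v])
    have nz: "ent v j \<noteq> 0" by (rule ent_nonzero[OF v j(1,2)])
    have "m = 2 * \<bar>ent v j\<bar> \<or> m = 2 * \<bar>ent v j\<bar> - 1" unfolding j(3) by presburger
    moreover have "\<bar>2 * ent v j\<bar> = 2 * \<bar>ent v j\<bar>" "\<bar>2 * ent v j - sgn (ent v j)\<bar> = 2 * \<bar>ent v j\<bar> - 1"
      using nz by (auto simp: sgn_if)
    ultimately have "m = \<bar>ent ?w (2 * j)\<bar> \<or> m = \<bar>ent ?w (2 * j - 1)\<bar>"
      using ent_double_word[of j v E] j(1,2) len by (cases "j \<in> E") auto
    moreover have "2 * j \<in> {1..2 * n}" "2 * j - 1 \<in> {1..2 * n}" using j by auto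
    ultimately show "m \<in> (\<lambda>i. \<bar>ent ?w i\<bar>) ` {1..2 * n}" by blast
  qed
  then show ?thesis by (simp add: signed_perms_iff_ent len)
qed

lemma paired_double_word: "v \<in> signed_perms n \<Longrightarrow> paired n (double_word v E)"
  using half_ent_double_word by (auto simp: paired_def unpaired_at_def)

lemma halve_double_word:
  assumes "v \<in> signed_perms n"
  shows "halve_word (double_word v E) = v"
proof (rule ent_eqI)
  show "length (halve_word (double_word v E)) = length v" by (simp add: halve_word_def)
next
  fix j assume "1 \<le> j" "j \<le> length v"
  then show "ent (halve_word (double_word v E)) j = ent v j"
    using half_ent_double_word(2)[OF assms] length_signed_perm[OF assms]
    by (simp add: ent_halve_word[where n = n])
qed

lemma less_F_double_word:
  assumes "v \<in> signed_perms n" "1 \<le> j" "j \<le> n"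
  shows "less_F (ent (double_word v E) (2 * j)) (ent (double_word v E) (2 * j - 1)) \<longleftrightarrow> j \<in> E"
  using ent_double_word[of j v E] length_signed_perm[OF assms(1)] assms(2,3)
    less_F_mate_double[OF ent_nonzero[OF assms]] less_F_asym by auto

lemma reversed_pairs_double_word:
  "v \<in> signed_perms n \<Longrightarrow> E \<subseteq> {1..n} \<Longrightarrow> reversed_pairs n (double_word v E) = E"
  using less_F_double_word[of v n] by (auto simp: reversed_pairs_def)

lemma paired_half_eq:
  assumes "paired n w" "1 \<le> j" "j \<le> n"
  shows "half (ent w (2 * j - 1)) = half (ent w (2 * j))"
  using assms by (auto simp: paired_def unpaired_at_def)

lemma halve_word_signed_perms:
  assumes w: "w \<in> signed_perms (2 * n)" "paired n w"
  shows "halve_word w \<in> signed_perms n"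
proof -
  note len = length_signed_perm[OF w(1)]
  have "(\<lambda>j. \<bar>ent (halve_word w) j\<bar>) ` {1..n} = (\<lambda>j. \<bar>half (ent w (2 * j))\<bar>) ` {1..n}"
    by (auto simp: ent_halve_word[OF len])
  also have "\<dots> = {1..int n}"
  proof (intro equalityI subsetI)
    fix k assume "k \<in> (\<lambda>j. \<bar>half (ent w (2 * j))\<bar>) ` {1..n}"
    then show "k \<in> {1..int n}" using abs_half_ent_bounds[OF w(1)] by auto
  next
    fix k assume "k \<in> {1..int n}"
    then have "1 \<le> 2 * k" "2 * k \<le> int (2 * n)" by auto
    then obtain i where i: "1 \<le> i" "i \<le> 2 * n" and k: "\<bar>ent w i\<bar> = 2 * k" by (rule abs_ent_surj[OF w(1)])
    from i obtain j where j: "1 \<le> j" "j \<le> n" "i = 2 * j - 1 \<or> i = 2 * j" by (rule position_in_pair)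
    have "\<bar>half (ent w (2 * j))\<bar> = \<bar>half (ent w i)\<bar>"
      using paired_half_eq[OF w(2) j(1,2)] j(3) by auto
    also have "\<dots> = k" using k by (simp add: abs_half)
    finally show "k \<in> (\<lambda>j. \<bar>half (ent w (2 * j))\<bar>) ` {1..n}" using j by auto
  qed
  finally show ?thesis using len by (simp add: signed_perms_iff_ent halve_word_def)
qed

lemma double_halve_word:
  assumes w: "w \<in> signed_perms (2 * n)" "paired n w"
  shows "double_word (halve_word w) (reversed_pairs n w) = w"
proof (rule ent_eqI)
  note len = length_signed_perm[OF w(1)]
  have lenh: "length (halve_word w) = n" using len by (simp add: halve_word_def)
  then show "length (double_word (halve_word w) (reversed_pairs n w)) = length w" by (simp add: len)
  fix i assume "1 \<le> i" "i \<le> length w"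
  then obtain j where j: "1 \<le> j" "j \<le> n" "i = 2 * j - 1 \<or> i = 2 * j"
    using position_in_pair[of i n] len by auto
  define b c a where "b = ent w (2 * j - 1)" and "c = ent w (2 * j)" and "a = half c"
  have pos: "1 \<le> 2 * j - 1" "2 * j - 1 \<le> 2 * n" "1 \<le> 2 * j" "2 * j \<le> 2 * n" using j by auto
  have nz: "b \<noteq> 0" "c \<noteq> 0"
    using ent_nonzero[OF w(1) pos(1,2)] ent_nonzero[OF w(1) pos(3,4)] by (simp_all add: b_def c_def)
  have "half b = a" using paired_half_eq[OF w(2) j(1,2)] by (simp add: a_def b_def c_def)
  have "a \<noteq> 0"
    using half_neg_iff[of c] half_pos_iff[of c] nz by (auto simp: a_def)
  have "b = 2 * a \<or> b = 2 * a - sgn a" "c = 2 * a \<or> c = 2 * a - sgn a"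
    using half_eq_cases[of "2 * a" b] half_eq_cases[of "2 * a" c] nz \<open>a \<noteq> 0\<close> \<open>half b = a\<close>
    by (auto simp: half_double mate_double a_def)
  moreover have "b \<noteq> c"
    using abs_ent_inj[OF w(1) _ pos] j(1) by (auto simp: b_def c_def)
  moreover have "j \<in> reversed_pairs n w \<longleftrightarrow> less_F c b"
    using j by (simp add: reversed_pairs_def b_def c_def)
  moreover have "ent (halve_word w) j = a"
    using j by (simp add: ent_halve_word[OF len] a_def c_def)
  ultimately have "ent (double_word (halve_word w) (reversed_pairs n w)) (2 * j - 1) = b"
    "ent (double_word (halve_word w) (reversed_pairs n w)) (2 * j) = c"
    using ent_double_word[of j "halve_word w" "reversed_pairs n w"] j lenh
      less_F_mate_double[OF \<open>a \<noteq> 0\<close>] less_F_asym[of "2 * a" "2 * a - sgn a"]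
    by auto
  then show "ent (double_word (halve_word w) (reversed_pairs n w)) i = ent w i"
    using j(3) by (auto simp: b_def c_def)
qed

lemma Neg_double_word:
  assumes v: "v \<in> signed_perms n"
  shows "Neg (double_word v E) = (\<Union>j\<in>Neg v. {2 * j - 1, 2 * j})"
proof (intro equalityI subsetI)
  note len = length_signed_perm[OF v]
  let ?w = "double_word v E"
  have neg: "ent ?w (2 * j - 1) < 0 \<longleftrightarrow> ent v j < 0" "ent ?w (2 * j) < 0 \<longleftrightarrow> ent v j < 0"
    if "1 \<le> j" "j \<le> n" for j
    using half_ent_double_word[OF v that, of E] half_neg_iff by metis+
  {
    fix i assume "i \<in> Neg ?w"
    then have i: "1 \<le> i" "i \<le> 2 * n" and "ent ?w i < 0" by (auto simp: Neg_def len)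
    from i obtain j where j: "1 \<le> j" "j \<le> n" "i = 2 * j - 1 \<or> i = 2 * j" by (rule position_in_pair)
    with neg[OF j(1,2)] \<open>ent ?w i < 0\<close> have "j \<in> Neg v" by (auto simp: Neg_def len)
    with j(3) show "i \<in> (\<Union>j\<in>Neg v. {2 * j - 1, 2 * j})" by auto
  next
    fix i assume "i \<in> (\<Union>j\<in>Neg v. {2 * j - 1, 2 * j})"
    then obtain j where j: "1 \<le> j" "j \<le> n" "ent v j < 0" "i = 2 * j - 1 \<or> i = 2 * j"
      by (auto simp: Neg_def len)
    moreover have "1 \<le> i" "i \<le> 2 * n" using j by auto
    ultimately show "i \<in> Neg ?w" using neg[OF j(1,2)] by (auto simp: Neg_def len)
  }
qed

lemma Des_F_double_word:
  assumes v: "v \<in> signed_perms n" and E: "E \<subseteq> {1..n}"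
  shows "Des_F (double_word v E) = (\<lambda>j. 2 * j) ` Des_F v \<union> (\<lambda>j. 2 * j - 1) ` E"
proof -
  note len = length_signed_perm[OF v]
  let ?w = "double_word v E"
  have between: "less_F (ent ?w (2 * j + 1)) (ent ?w (2 * j)) \<longleftrightarrow> less_F (ent v (j + 1)) (ent v j)"
    if j: "1 \<le> j" "j < n" for j
  proof -
    have "half (ent ?w (2 * j + 1)) = ent v (j + 1)"
      using half_ent_double_word(1)[OF v, of "j + 1" E] j by simp
    moreover have "half (ent ?w (2 * j)) = ent v j"
      using half_ent_double_word(2)[OF v, of j E] j by simp
    moreover have "ent v (j + 1) \<noteq> ent v j"
      using abs_ent_inj[OF v, of "j + 1" j] j by auto
    ultimately show ?thesis using less_F_half[of "ent ?w (2 * j + 1)" "ent ?w (2 * j)"] by simp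
  qed
  show ?thesis
  proof (intro equalityI subsetI)
    fix i assume "i \<in> Des_F ?w"
    then have i: "1 \<le> i" "i < 2 * n" and d: "less_F (ent ?w (i + 1)) (ent ?w i)"
      by (auto simp: Des_F_def len)
    from i obtain j where j: "1 \<le> j" "j \<le> n" "i = 2 * j - 1 \<or> i = 2 * j"
      using position_in_pair[of i n] by auto
    from j(3) show "i \<in> (\<lambda>j. 2 * j) ` Des_F v \<union> (\<lambda>j. 2 * j - 1) ` E"
    proof
      assume i': "i = 2 * j - 1"
      then have "i + 1 = 2 * j" using j by simp
      with d i' less_F_double_word[OF v j(1,2)] show ?thesis by auto
    next
      assume i': "i = 2 * j"
      with i have "j < n" by simp
      with d i' between[OF j(1)] have "j \<in> Des_F v" using j by (simp add: Des_F_def len)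
      with i' show ?thesis by simp
    qed
  next
    fix i assume "i \<in> (\<lambda>j. 2 * j) ` Des_F v \<union> (\<lambda>j. 2 * j - 1) ` E"
    then show "i \<in> Des_F ?w"
    proof
      assume "i \<in> (\<lambda>j. 2 * j) ` Des_F v"
      then obtain j where "1 \<le> j" "j < n" "less_F (ent v (j + 1)) (ent v j)" "i = 2 * j"
        by (auto simp: Des_F_def len)
      with between show ?thesis by (simp add: Des_F_def len)
    next
      assume "i \<in> (\<lambda>j. 2 * j - 1) ` E"
      then obtain j where j: "j \<in> E" "1 \<le> j" "j \<le> n" "i = 2 * j - 1" using E by auto
      then have "i + 1 = 2 * j" "1 \<le> i" "i < 2 * n" by auto
      with j less_F_double_word[OF v j(2,3)] show ?thesis by (simp add: Des_F_def len)
    qed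
  qed
qed

text \<open>An inversion of \<open>\<bar>v\<bar>\<close> gives four inversions, one for each choice of a position in either pair,
  and the only other inversions are those within a pair, at the places in \<open>E\<close>.\<close>

lemma even_invs_double_word:
  assumes v: "v \<in> signed_perms n" and E: "E \<subseteq> {1..n}"
  shows "even (invs (map abs (double_word v E))) \<longleftrightarrow> even (card E)"
proof -
  note len = length_signed_perm[OF v]
  define p where "p = map abs (double_word v E)"
  have lenp: "length p = 2 * n" by (simp add: p_def len)
  have p: "ent p (2 * j - 1) = (if j \<in> E then 2 * \<bar>ent v j\<bar> else 2 * \<bar>ent v j\<bar> - 1)"
      "ent p (2 * j) = (if j \<in> E then 2 * \<bar>ent v j\<bar> - 1 else 2 * \<bar>ent v j\<bar>)"
    if j: "1 \<le> j" "j \<le> n" for j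
  proof -
    have pos: "1 \<le> 2 * j - 1" "2 * j - 1 \<le> length (double_word v E)"
      "1 \<le> 2 * j" "2 * j \<le> length (double_word v E)" using j by (auto simp: len)
    have "\<bar>2 * ent v j\<bar> = 2 * \<bar>ent v j\<bar>" "\<bar>2 * ent v j - sgn (ent v j)\<bar> = 2 * \<bar>ent v j\<bar> - 1"
      using ent_nonzero[OF v j] by (auto simp: sgn_if)
    then show "ent p (2 * j - 1) = (if j \<in> E then 2 * \<bar>ent v j\<bar> else 2 * \<bar>ent v j\<bar> - 1)"
      "ent p (2 * j) = (if j \<in> E then 2 * \<bar>ent v j\<bar> - 1 else 2 * \<bar>ent v j\<bar>)"
      unfolding p_def ent_map[OF pos(1,2)] ent_map[OF pos(3,4)]
      using ent_double_word[of j v E] j by (simp_all add: len)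
  qed
  define I where "I = {(i, j). 1 \<le> i \<and> i < j \<and> j \<le> n \<and> \<bar>ent v i\<bar> > \<bar>ent v j\<bar>}"
  define J where "J = {(i, j). 1 \<le> i \<and> i < j \<and> j \<le> 2 * n \<and> ent p i > ent p j}"
  let ?f = "\<lambda>((i, j), (c, d)). (2 * i - c, 2 * j - d) :: nat \<times> nat"
  let ?X = "I \<times> ({0, 1} \<times> {0, 1})"
  have val: "ent p (2 * j - c) = 2 * \<bar>ent v j\<bar> \<or> ent p (2 * j - c) = 2 * \<bar>ent v j\<bar> - 1"
    if "1 \<le> j" "j \<le> n" "c \<in> {0, 1}" for j c
    using p[OF that(1,2)] that(3) by (auto split: if_splits)
  have across: "ent p (2 * i - c) > ent p (2 * j - d) \<longleftrightarrow> \<bar>ent v i\<bar> > \<bar>ent v j\<bar>"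
    if "1 \<le> i" "i < j" "j \<le> n" "c \<in> {0, 1}" "d \<in> {0, 1}" for i j c d
  proof -
    have "\<bar>ent v i\<bar> \<noteq> \<bar>ent v j\<bar>" using abs_ent_inj[OF v, of i j] that by linarith
    moreover have "1 \<le> j" "i \<le> n" using that by auto
    ultimately show ?thesis using val[of i c] val[of j d] that by linarith
  qed
  have "J = ?f ` ?X \<union> (\<lambda>j. (2 * j - 1, 2 * j)) ` E"
  proof (intro equalityI subsetI)
    fix z assume "z \<in> J"
    then obtain a b where z: "z = (a, b)" and ab: "1 \<le> a" "a < b" "b \<le> 2 * n" "ent p a > ent p b"
      by (auto simp: J_def)
    obtain i where i: "1 \<le> i" "i \<le> n" "a = 2 * i - 1 \<or> a = 2 * i"
      using position_in_pair[of a n] ab by auto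
    obtain j where j: "1 \<le> j" "j \<le> n" "b = 2 * j - 1 \<or> b = 2 * j"
      using position_in_pair[of b n] ab by auto
    obtain c where c: "c \<in> {0, 1}" "a = 2 * i - c" using i(3) by force
    obtain d where d: "d \<in> {0, 1}" "b = 2 * j - d" using j(3) by force
    have "i \<le> j" using c d ab(2) i j by auto
    show "z \<in> ?f ` ?X \<union> (\<lambda>j. (2 * j - 1, 2 * j)) ` E"
    proof (cases "i = j")
      case True
      then have "a = 2 * j - 1" "b = 2 * j" using ab(2) i(3) j(3) by auto
      moreover from this ab(4) p[OF j(1,2)] have "j \<in> E" by (auto split: if_splits)
      ultimately show ?thesis by (auto simp: z)
    next
      case False
      with \<open>i \<le> j\<close> have "i < j" by simp
      with across[OF i(1) _ j(2) c(1) d(1)] ab(4) c(2) d(2) have "(i, j) \<in> I"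
        using i j by (simp add: I_def)
      then have "z \<in> ?f ` ?X"
        using c d by (intro image_eqI[of _ _ "((i, j), (c, d))"]) (auto simp: z)
      then show ?thesis ..
    qed
  next
    fix z assume "z \<in> ?f ` ?X \<union> (\<lambda>j. (2 * j - 1, 2 * j)) ` E"
    then show "z \<in> J"
    proof
      assume "z \<in> ?f ` ?X"
      then obtain i j c d where z: "z = (2 * i - c, 2 * j - d)" and ij: "(i, j) \<in> I"
        and cd: "c \<in> {0, 1}" "d \<in> {0, 1}" by auto
      then have ij': "1 \<le> i" "i < j" "j \<le> n" "\<bar>ent v i\<bar> > \<bar>ent v j\<bar>" by (auto simp: I_def)
      with across[OF ij'(1-3) cd] have "ent p (2 * i - c) > ent p (2 * j - d)" by simp
      moreover have "1 \<le> 2 * i - c" "2 * i - c < 2 * j - d" "2 * j - d \<le> 2 * n" using ij' cd by auto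
      ultimately show ?thesis by (simp add: J_def z)
    next
      assume "z \<in> (\<lambda>j. (2 * j - 1, 2 * j)) ` E"
      then obtain j where j: "j \<in> E" "1 \<le> j" "j \<le> n" "z = (2 * j - 1, 2 * j)" using E by auto
      moreover have "1 \<le> 2 * j - 1" "2 * j - 1 < 2 * j" using j by auto
      ultimately show ?thesis using p[OF j(2,3)] by (simp add: J_def)
    qed
  qed
  moreover have "?f ` ?X \<inter> (\<lambda>j. (2 * j - 1, 2 * j)) ` E = {}"
  proof -
    have apart: False if "(2 * i - c, 2 * j - d) = (2 * m - 1, 2 * m)" "(i, j) \<in> I" "m \<in> E"
      "c \<in> {0, 1}" "d \<in> {0, 1}" for i j c d m
    proof -
      have "1 \<le> i" "i < j" "1 \<le> m" using that(2,3) E by (auto simp: I_def)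
      moreover from this have "i = m" "j = m"
        using pair_position_inj[of i m c 1] pair_position_inj[of j m d 0] that by auto
      ultimately show False by simp
    qed
    show ?thesis
    proof (rule equals0I, elim IntE)
      fix z assume "z \<in> ?f ` ?X" "z \<in> (\<lambda>j. (2 * j - 1, 2 * j)) ` E"
      from this(1) obtain i j c d where z: "z = (2 * i - c, 2 * j - d)" and ij: "(i, j) \<in> I"
        and cd: "c \<in> {0, 1}" "d \<in> {0, 1}" by auto
      from \<open>z \<in> (\<lambda>j. (2 * j - 1, 2 * j)) ` E\<close> obtain m
        where m: "m \<in> E" "z = (2 * m - 1, 2 * m)" by blast
      show False by (rule apart[OF trans[OF z[symmetric] m(2)] ij m(1) cd])
    qed
  qed
  moreover have "finite I" unfolding I_def by (rule finite_position_pairs)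
  moreover have "finite E" using E finite_subset by blast
  ultimately have "card J = card (?f ` ?X) + card ((\<lambda>j. (2 * j - 1, 2 * j)) ` E)"
    by (simp add: card_Un_disjoint)
  also have "card (?f ` ?X) = card I * 4"
  proof -
    have "inj_on ?f ?X"
    proof (rule inj_onI)
      fix y z assume y: "y \<in> ?X" and z: "z \<in> ?X" and yz: "?f y = ?f z"
      obtain i j c d where y': "y = ((i, j), (c, d))" by (metis prod.exhaust)
      obtain i' j' c' d' where z': "z = ((i', j'), (c', d'))" by (metis prod.exhaust)
      have eq: "2 * i - c = 2 * i' - c'" "2 * j - d = 2 * j' - d'" using yz by (simp_all add: y' z')
      have cd: "c \<in> {0, 1}" "d \<in> {0, 1}" "c' \<in> {0, 1}" "d' \<in> {0, 1}"
        using y z unfolding y' z' by blast+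
      have "1 \<le> i" "1 \<le> j" "1 \<le> i'" "1 \<le> j'" using y z by (auto simp: I_def y' z')
      then show "y = z"
        using pair_position_inj[OF _ _ cd(1,3) eq(1)] pair_position_inj[OF _ _ cd(2,4) eq(2)]
        by (simp add: y' z')
    qed
    then show ?thesis by (simp add: card_image card_cartesian_product)
  qed
  also have "card ((\<lambda>j. (2 * j - 1, 2 * j)) ` E) = card E"
    by (rule card_image) (auto simp: inj_on_def)
  finally have "invs p = card I * 4 + card E" by (simp add: invs_def J_def lenp)
  then show ?thesis by (simp add: p_def)
qed


section \<open>The signed sum over all signed permutations\<close>

lemma sum_signed_perms_double:
  fixes g :: "nat set \<Rightarrow> nat set \<Rightarrow> 'a :: comm_ring_1"
  shows "(\<Sum>w\<in>signed_perms (2 * n). (- 1) ^ invs (map abs w) * g (Des_F w) (Neg w))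
       = (\<Sum>v\<in>signed_perms n. \<Sum>E\<in>Pow {1..n}. (- 1) ^ card E
            * g ((\<lambda>j. 2 * j) ` Des_F v \<union> (\<lambda>j. 2 * j - 1) ` E) (\<Union>j\<in>Neg v. {2 * j - 1, 2 * j}))"
    (is "?lhs = ?rhs")
proof -
  let ?s = "\<lambda>w. (- 1) ^ invs (map abs w) * g (Des_F w) (Neg w)"
  let ?A = "{w \<in> signed_perms (2 * n). paired n w}"
  have "?lhs = sum ?s ?A + sum ?s {w \<in> signed_perms (2 * n). \<not> paired n w}"
    by (subst sum.union_disjoint[symmetric]) (auto simp: finite_signed_perms intro!: sum.cong)
  also have "\<dots> = sum ?s ?A" by (simp add: sum_unpaired_eq_0)
  also have "\<dots> = (\<Sum>(v, E)\<in>signed_perms n \<times> Pow {1..n}. (- 1) ^ card E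
      * g ((\<lambda>j. 2 * j) ` Des_F v \<union> (\<lambda>j. 2 * j - 1) ` E) (\<Union>j\<in>Neg v. {2 * j - 1, 2 * j}))"
  proof (rule sum.reindex_bij_witness[of _ "\<lambda>(v, E). double_word v E"
        "\<lambda>w. (halve_word w, reversed_pairs n w)"])
    fix w assume "w \<in> ?A"
    then have w: "w \<in> signed_perms (2 * n)" "paired n w" by auto
    let ?v = "halve_word w" and ?E = "reversed_pairs n w"
    note restore = double_halve_word[OF w]
    show "(case (?v, ?E) of (v, E) \<Rightarrow> double_word v E) = w" using restore by simp
    have v: "?v \<in> signed_perms n" by (rule halve_word_signed_perms[OF w])
    have E: "?E \<subseteq> {1..n}" by (auto simp: reversed_pairs_def)
    show "(?v, ?E) \<in> signed_perms n \<times> Pow {1..n}" using v E by simp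
    show "(case (?v, ?E) of (v, E) \<Rightarrow> (- 1) ^ card E
        * g ((\<lambda>j. 2 * j) ` Des_F v \<union> (\<lambda>j. 2 * j - 1) ` E) (\<Union>j\<in>Neg v. {2 * j - 1, 2 * j})) = ?s w"
      using even_invs_double_word[OF v E] Des_F_double_word[OF v E] Neg_double_word[OF v, of ?E]
      by (simp add: restore minus_one_power_iff)
  qed (auto simp: double_word_signed_perms paired_double_word halve_double_word
        reversed_pairs_double_word)
  also have "\<dots> = ?rhs" by (simp add: sum.cartesian_product)
  finally show ?thesis .
qed

lemma fdes_eq: "w \<noteq> [] \<Longrightarrow> fdes w = 2 * card (Des_F w) + (if 1 \<in> Neg w then 1 else 0)"
  by (cases w) (auto simp: fdes_def des_F_def Neg_def)

lemma fmaj_eq: "fmaj w = 2 * \<Sum>(Des_F w) + card (Neg w)"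
  by (simp add: fmaj_def maj_F_def neg_def)

lemma finite_Des_F: "finite (Des_F w)"
  by (rule finite_subset[of _ "{..length w}"]) (auto simp: Des_F_def)

lemma finite_Neg: "finite (Neg w)"
  by (simp add: Neg_def)

lemma UN_pairs:
  fixes A :: "nat set"
  assumes "finite A" "0 \<notin> A"
  shows card_UN_pairs: "card (\<Union>j\<in>A. {2 * j - 1, 2 * j}) = 2 * card A"
    and prod_UN_pairs: "(\<Prod>i\<in>(\<Union>j\<in>A. {2 * j - 1, 2 * j}). f i) = (\<Prod>j\<in>A. f (2 * j - 1) * f (2 * j) :: 'a :: comm_monoid_mult)"
proof -
  have neq: "2 * j - 1 \<noteq> 2 * j" if "j \<in> A" for j using that assms(2) by (cases j) auto
  have disj: "{2 * i - 1, 2 * i} \<inter> {2 * j - 1, 2 * j} = {}" if "i \<in> A" "j \<in> A" "i \<noteq> j" for i j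
  proof -
    have "i > 0" "j > 0" using that assms(2) by (metis gr0I)+
    with that(3) show ?thesis by auto
  qed
  have "card (\<Union>j\<in>A. {2 * j - 1, 2 * j}) = (\<Sum>j\<in>A. card {2 * j - 1, 2 * j})"
    by (rule card_UN_disjoint) (use assms disj in auto)
  also have "\<dots> = (\<Sum>j\<in>A. 2)" using neq by (intro sum.cong) auto
  finally show "card (\<Union>j\<in>A. {2 * j - 1, 2 * j}) = 2 * card A" by simp
  have "(\<Prod>i\<in>(\<Union>j\<in>A. {2 * j - 1, 2 * j}). f i) = (\<Prod>j\<in>A. \<Prod>i\<in>{2 * j - 1, 2 * j}. f i)"
    by (rule prod.UNION_disjoint) (use assms disj in auto)
  also have "\<dots> = (\<Prod>j\<in>A. f (2 * j - 1) * f (2 * j))"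
    using neq by (intro prod.cong) auto
  finally show "(\<Prod>i\<in>(\<Union>j\<in>A. {2 * j - 1, 2 * j}). f i) = (\<Prod>j\<in>A. f (2 * j - 1) * f (2 * j))" .
qed

text \<open>The weight \<open>c\<close> carries the indeterminates \<open>x\<^sub>i\<close>.  Being arbitrary, it can also vanish on the words
  with a negative last letter, and so the identity covers sums restricted by the signs of letters.\<close>

theorem signed_sum_fdes_fmaj:
  fixes t q :: "'a :: comm_ring_1" and c :: "nat set \<Rightarrow> 'a"
  assumes n: "n \<ge> 1"
  shows "(\<Sum>w\<in>signed_perms (2 * n). (- 1) ^ invs (map abs w) * (t ^ fdes w * q ^ fmaj w * c (Neg w)))
       = (\<Prod>i=1..n. 1 - t ^ 2 * q ^ (4 * i - 2))
         * (\<Sum>v\<in>signed_perms n. t ^ fdes v * q ^ (2 * fmaj v) * c (\<Union>j\<in>Neg v. {2 * j - 1, 2 * j}))"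
proof -
  define g where "g D S = t ^ (2 * card D + (if 1 \<in> S then 1 else 0)) * q ^ (2 * \<Sum>D + card S) * c S"
    for D S :: "nat set"
  let ?D = "\<lambda>v E. (\<lambda>j. 2 * j) ` Des_F v \<union> (\<lambda>j. 2 * j - 1) ` E"
  let ?S = "\<lambda>v. \<Union>j\<in>Neg v. {2 * j - 1, 2 * j}"
  let ?b = "\<lambda>v. t ^ fdes v * q ^ (2 * fmaj v) * c (?S v)"
  have g: "t ^ fdes w * q ^ fmaj w * c (Neg w) = g (Des_F w) (Neg w)" if "w \<in> signed_perms (2 * n)" for w
  proof -
    have "w \<noteq> []" using length_signed_perm[OF that] n by auto
    then show ?thesis by (simp add: g_def fdes_eq fmaj_eq)
  qed
  have summand: "(- 1) ^ card E * g (?D v E) (?S v)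
      = ?b v * ((\<Prod>j\<in>E. - (t ^ 2 * q ^ (4 * j - 2))) * (\<Prod>j\<in>{1..n} - E. 1))"
    if v: "v \<in> signed_perms n" and E: "E \<in> Pow {1..n}" for v E
  proof -
    have "v \<noteq> []" using length_signed_perm[OF v] n by auto
    have finE: "finite E" and E0: "0 \<notin> E" using E finite_subset[of E "{1..n}"] by auto
    have N0: "0 \<notin> Neg v" by (simp add: Neg_def)
    have disj: "(\<lambda>j. 2 * j) ` Des_F v \<inter> (\<lambda>j. 2 * j - 1) ` E = {}"
    proof -
      have "2 * i \<noteq> 2 * j - 1" if "j \<in> E" for i j :: nat
      proof -
        have "j \<noteq> 0" using that E0 by metis
        then show ?thesis by presburger
      qed
      then show ?thesis by auto
    qed
    have inj: "inj_on (\<lambda>j. 2 * j - 1) E"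
    proof (rule inj_onI)
      fix i j assume "i \<in> E" "j \<in> E" "2 * i - 1 = 2 * j - 1"
      moreover from this have "i \<noteq> 0" "j \<noteq> 0" using E0 by metis+
      ultimately show "i = j" by simp
    qed
    have cardD: "card (?D v E) = card (Des_F v) + card E"
      using disj finE inj by (simp add: card_Un_disjoint finite_Des_F card_image inj_on_def)
    have "\<Sum>(?D v E) = \<Sum>((\<lambda>j. 2 * j) ` Des_F v) + \<Sum>((\<lambda>j. 2 * j - 1) ` E)"
      using disj finE by (intro sum.union_disjoint) (auto simp: finite_Des_F)
    also have "\<Sum>((\<lambda>j. 2 * j) ` Des_F v) = 2 * \<Sum>(Des_F v)"
      by (subst sum.reindex) (auto simp: inj_on_def sum_distrib_left)
    also have "\<Sum>((\<lambda>j. 2 * j - 1) ` E) = (\<Sum>j\<in>E. 2 * j - 1)"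
      using inj by (simp add: sum.reindex)
    finally have sumD: "\<Sum>(?D v E) = 2 * \<Sum>(Des_F v) + (\<Sum>j\<in>E. 2 * j - 1)" .
    have double: "2 * (\<Sum>j\<in>E. 2 * j - 1) = (\<Sum>j\<in>E. 4 * j - 2)"
      by (simp add: sum_distrib_left diff_mult_distrib2)
    have one: "1 \<in> ?S v \<longleftrightarrow> 1 \<in> Neg v"
    proof -
      have "1 \<in> {2 * j - 1, 2 * j} \<longleftrightarrow> j = 1" for j :: nat by auto
      then show ?thesis by simp
    qed
    have "g (?D v E) (?S v) = ?b v * (t ^ (2 * card E) * q ^ (\<Sum>j\<in>E. 4 * j - 2))"
      unfolding g_def cardD sumD one card_UN_pairs[OF finite_Neg N0] distrib_left double
      by (simp add: fdes_eq[OF \<open>v \<noteq> []\<close>] fmaj_eq power_add mult_ac)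
    moreover have "(\<Prod>j\<in>E. - (t ^ 2 * q ^ (4 * j - 2)))
        = (- 1) ^ card E * (t ^ (2 * card E) * q ^ (\<Sum>j\<in>E. 4 * j - 2))"
      by (simp add: prod_uminus prod.distrib power_sum power_mult)
    ultimately show ?thesis by (simp add: mult_ac)
  qed
  have "(\<Sum>w\<in>signed_perms (2 * n). (- 1) ^ invs (map abs w) * (t ^ fdes w * q ^ fmaj w * c (Neg w)))
      = (\<Sum>w\<in>signed_perms (2 * n). (- 1) ^ invs (map abs w) * g (Des_F w) (Neg w))"
    using g by (intro sum.cong) auto
  also have "\<dots> = (\<Sum>v\<in>signed_perms n. \<Sum>E\<in>Pow {1..n}. (- 1) ^ card E * g (?D v E) (?S v))"
    by (rule sum_signed_perms_double)
  also have "\<dots> = (\<Sum>v\<in>signed_perms n. \<Sum>E\<in>Pow {1..n}.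
      ?b v * ((\<Prod>j\<in>E. - (t ^ 2 * q ^ (4 * j - 2))) * (\<Prod>j\<in>{1..n} - E. 1)))"
    using summand by (intro sum.cong refl) blast
  also have "\<dots> = (\<Sum>v\<in>signed_perms n. ?b v * (\<Prod>j=1..n. - (t ^ 2 * q ^ (4 * j - 2)) + 1))"
    by (simp only: sum_distrib_left[symmetric] prod_add finite_atLeastAtMost)
  also have "\<dots> = (\<Prod>i=1..n. 1 - t ^ 2 * q ^ (4 * i - 2)) * (\<Sum>v\<in>signed_perms n. ?b v)"
    by (simp add: sum_distrib_left mult.commute)
  finally show ?thesis .
qed

section \<open>From type D to type B\<close>

lemma Neg_append_last: "Neg (u @ [a]) = Neg u \<union> (if a < 0 then {Suc (length u)} else {})"
  by (auto simp: Neg_def ent_def nth_append split: if_splits)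

lemma last_position_notin_Neg: "Suc (length u) \<notin> Neg u"
  by (simp add: Neg_def)

lemma Neg_abs_last: "w \<noteq> [] \<Longrightarrow> Neg (abs_last w) = Neg w - {length w}"
  by (cases w rule: rev_cases) (auto simp: abs_last_def Neg_append_last last_position_notin_Neg)

lemma map_abs_abs_last: "w \<noteq> [] \<Longrightarrow> map abs (abs_last w) = map abs w"
  by (cases w rule: rev_cases) (simp_all add: abs_last_def)

text \<open>An element of \<open>\<D>\<^sub>N\<close> is determined by its image under \<^const>\<open>abs_last\<close>, since the sign of the last
  letter makes the number of negative letters even.\<close>

lemma sum_even_signed_perms:
  fixes f :: "int list \<Rightarrow> 'a :: comm_monoid_add"
  assumes N: "N \<ge> 1"
  shows "(\<Sum>w\<in>even_signed_perms N. f (abs_last w)) = (\<Sum>w\<in>{w \<in> signed_perms N. N \<notin> Neg w}. f w)"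
proof (rule sum.reindex_bij_witness[of _ "\<lambda>w. if even (neg w) then w else butlast w @ [- last w]" abs_last])
  have mem: "u @ [- a] \<in> signed_perms N \<longleftrightarrow> u @ [a] \<in> signed_perms N" for u a
    by (simp add: signed_perms_iff)
  have ne: "w \<noteq> []" if "w \<in> signed_perms N" for w
    using that N by (auto simp: signed_perms_iff)
  have nz: "0 \<notin> set w" if "w \<in> signed_perms N" for w
  proof
    assume "0 \<in> set w"
    then have "0 \<in> abs ` set w" by force
    with that show False by (simp add: signed_perms_iff)
  qed
  have neg_snoc: "neg (u @ [a]) = neg u + (if a < 0 then 1 else 0)" for u a
    using last_position_notin_Neg[of u] by (simp add: neg_def Neg_append_last finite_Neg)
  have Neg_last: "N \<notin> Neg (u @ [a]) \<longleftrightarrow> a > 0" if "u @ [a] \<in> signed_perms N" for u a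
  proof -
    have "a \<noteq> 0" using nz[OF that] by auto
    moreover have "N = Suc (length u)" using that by (simp add: signed_perms_iff)
    ultimately show ?thesis using last_position_notin_Neg[of u] by (auto simp: Neg_append_last)
  qed
  {
    fix w assume "w \<in> even_signed_perms N"
    then have w: "w \<in> signed_perms N" "even (neg w)" by (auto simp: even_signed_perms_def)
    from ne[OF w(1)] obtain u a where wu: "w = u @ [a]" by (cases w rule: rev_cases) auto
    have "a \<noteq> 0" using nz[OF w(1)] by (auto simp: wu)
    have abs: "abs_last w = u @ [\<bar>a\<bar>]" by (simp add: abs_last_def wu)
    show "(if even (neg (abs_last w)) then abs_last w
        else butlast (abs_last w) @ [- last (abs_last w)]) = w"
      using w(2) \<open>a \<noteq> 0\<close> unfolding abs by (auto simp: wu neg_snoc split: if_splits)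
    have "abs_last w \<in> signed_perms N" using w(1) mem[of u a] unfolding abs by (simp add: wu abs_if)
    then show "abs_last w \<in> {w \<in> signed_perms N. N \<notin> Neg w}"
      using Neg_last[of u "\<bar>a\<bar>"] \<open>a \<noteq> 0\<close> by (simp add: abs)
    show "f (abs_last w) = f (abs_last w)" ..
  next
    fix w assume "w \<in> {w \<in> signed_perms N. N \<notin> Neg w}"
    then have w: "w \<in> signed_perms N" "N \<notin> Neg w" by auto
    from ne[OF w(1)] obtain u a where wu: "w = u @ [a]" by (cases w rule: rev_cases) auto
    have a: "a > 0" using Neg_last[of u a] w by (simp add: wu)
    show "abs_last (if even (neg w) then w else butlast w @ [- last w]) = w"
      using a by (simp add: wu abs_last_def)
    show "(if even (neg w) then w else butlast w @ [- last w]) \<in> even_signed_perms N"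
      using a w(1) mem[of u a] by (auto simp: wu even_signed_perms_def neg_snoc)
  }
qed

theorem theorem4p1:
  fixes n :: nat and t q :: "'a :: comm_ring_1" and x :: "nat \<Rightarrow> 'a"
  assumes "n \<ge> 1"
  shows "(\<Sum>w\<in>even_signed_perms (2 * n).
            (- 1) ^ nat (length_D w) * t ^ ddes w * q ^ dmaj w * (\<Prod>i\<in>Neg w. x i))
       = (\<Prod>i=1..n. 1 - t ^ 2 * q ^ (4 * i - 2))
         * (\<Sum>w\<in>even_signed_perms n.
              t ^ ddes w * q ^ (2 * dmaj w) * (\<Prod>i\<in>Neg w - {n}. x (2 * i - 1) * x (2 * i)))"
proof -
  \<comment> \<open>For \<open>w \<in> \<D>\<^sub>2\<^sub>n\<close> and \<open>S = Neg (abs_last w)\<close> the last letter of \<open>w\<close> is negative exactly if \<open>card S\<close> is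
    odd, so \<open>c S\<close> restores its factor.  The value 0 discards the words with a negative last
    letter.  On the right-hand side \<open>S\<close> is a union of pairs, its cardinality is even, and
    \<open>x (2 * n)\<close> no longer shows.\<close>
  define c where "c S = (if 2 * n \<in> S then 0 else (\<Prod>i\<in>S. x i) * (if even (card S) then 1 else x (2 * n)))"
    for S :: "nat set"
  let ?S = "\<lambda>v. \<Union>j\<in>Neg v. {2 * j - 1, 2 * j}"
  let ?B = "\<lambda>w. (- 1) ^ invs (map abs w) * (t ^ fdes w * q ^ fmaj w * c (Neg w))"
  let ?R = "\<lambda>v. t ^ fdes v * q ^ (2 * fmaj v) * c (?S v)"
  have N: "2 * n \<ge> 1" using assms by simp
  have lhs: "(- 1) ^ nat (length_D w) * t ^ ddes w * q ^ dmaj w * (\<Prod>i\<in>Neg w. x i) = ?B (abs_last w)"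
    if "w \<in> even_signed_perms (2 * n)" for w
  proof -
    from that have w: "w \<in> signed_perms (2 * n)" and ev: "even (card (Neg w))"
      by (auto simp: even_signed_perms_def neg_def)
    have len: "length w = 2 * n" and ne: "w \<noteq> []"
      using length_signed_perm[OF w] N by auto
    have sign: "(- 1) ^ nat (length_D w) = (- 1 :: 'a) ^ invs (map abs (abs_last w))"
      using even_length_D_iff[OF w] length_D_nonneg[of w]
      by (simp add: minus_one_power_iff map_abs_abs_last[OF ne] even_nat_iff)
    have "c (Neg (abs_last w)) = (\<Prod>i\<in>Neg w. x i)"
    proof (cases "2 * n \<in> Neg w")
      case True
      have "odd (card (Neg w - {2 * n}))"
        using ev unfolding card.remove[OF finite_Neg True] by simp
      then have "c (Neg (abs_last w)) = (\<Prod>i\<in>Neg w - {2 * n}. x i) * x (2 * n)"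
        unfolding c_def Neg_abs_last[OF ne] len by simp
      also have "\<dots> = (\<Prod>i\<in>Neg w. x i)"
        unfolding prod.remove[OF finite_Neg True, of x] by (rule mult.commute)
      finally show ?thesis .
    qed (use ev in \<open>simp add: c_def Neg_abs_last[OF ne] len\<close>)
    then show ?thesis by (simp add: sign ddes_def dmaj_def mult.assoc)
  qed
  have mem: "2 * n \<in> ?S v \<longleftrightarrow> n \<in> Neg v" for v
  proof -
    have "2 * n = 2 * j - 1 \<longleftrightarrow> n = 0 \<and> j = 0" for j by presburger
    with assms show ?thesis by auto
  qed
  have N0: "0 \<notin> Neg v" for v by (simp add: Neg_def)
  have c_pairs: "c (?S v) = (if n \<in> Neg v then 0 else \<Prod>i\<in>Neg v. x (2 * i - 1) * x (2 * i))" for v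
    unfolding c_def mem card_UN_pairs[OF finite_Neg N0] prod_UN_pairs[OF finite_Neg N0] by simp
  have rhs: "t ^ ddes w * q ^ (2 * dmaj w) * (\<Prod>i\<in>Neg w - {n}. x (2 * i - 1) * x (2 * i)) = ?R (abs_last w)"
    if "w \<in> even_signed_perms n" for w
  proof -
    have len: "length w = n" and ne: "w \<noteq> []"
      using that length_signed_perm[of w n] assms by (auto simp: even_signed_perms_def)
    show ?thesis unfolding c_pairs unfolding Neg_abs_last[OF ne] len ddes_def dmaj_def by simp
  qed
  have "(\<Sum>w\<in>even_signed_perms (2 * n).
            (- 1) ^ nat (length_D w) * t ^ ddes w * q ^ dmaj w * (\<Prod>i\<in>Neg w. x i))
      = (\<Sum>w\<in>even_signed_perms (2 * n). ?B (abs_last w))"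
    by (rule sum.cong[OF refl lhs])
  also have "\<dots> = (\<Sum>w\<in>{w \<in> signed_perms (2 * n). 2 * n \<notin> Neg w}. ?B w)"
    by (rule sum_even_signed_perms[OF N])
  also have "\<dots> = (\<Sum>w\<in>signed_perms (2 * n). ?B w)"
    by (rule sum.mono_neutral_left) (auto simp: finite_signed_perms c_def)
  also have "\<dots> = (\<Prod>i=1..n. 1 - t ^ 2 * q ^ (4 * i - 2)) * (\<Sum>v\<in>signed_perms n. ?R v)"
    by (rule signed_sum_fdes_fmaj[OF assms])
  also have "(\<Sum>v\<in>signed_perms n. ?R v) = (\<Sum>v\<in>{v \<in> signed_perms n. n \<notin> Neg v}. ?R v)"
  proof (rule sum.mono_neutral_right)
    show "\<forall>v\<in>signed_perms n - {v \<in> signed_perms n. n \<notin> Neg v}. ?R v = 0"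
      unfolding c_pairs by simp
  qed (auto simp: finite_signed_perms)
  also have "\<dots> = (\<Sum>w\<in>even_signed_perms n. ?R (abs_last w))"
    by (rule sum_even_signed_perms[OF assms, symmetric])
  also have "\<dots> = (\<Sum>w\<in>even_signed_perms n.
      t ^ ddes w * q ^ (2 * dmaj w) * (\<Prod>i\<in>Neg w - {n}. x (2 * i - 1) * x (2 * i)))"
    by (rule sum.cong[OF refl rhs[symmetric]])
  finally show ?thesis .
qed

end
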